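(* Let $(X,\triangleright)$ be a left shelf and let $\varphi: X\to \mathrm{Sym}_X$, $a\mapsto\varphi_a$, be a map. Then the function $r_\varphi: X\times X\to X\times X$ defined by $$r_\varphi(a,b)=\left(\varphi_a(b),\ \varphi^{-1}_{\varphi_a(b)}\big(\varphi_a(b)\triangleright a\big)\right)\qquad (a,b\in X)$$ is a solution if and only if $\varphi$ is a twist of $(X,\triangleright)$. Moreover, any left non-degenerate solution can be obtained in that way (that is, any left non-degenerate solution on a set $X$ equals $r_\varphi$ for some left shelf structure $\triangleright$ on $X$ and some twist $\varphi$ of $(X,\triangleright)$).
   Context: A solution $(X,r)$ is a set $X$ with a map $r:X\times X\to X\times X$ satisfying the braid identity $(r\times \mathrm{id}_X)(\mathrm{id}_X\times r)(r\times\mathrm{id}_X)=(\mathrm{id}_X\times r)(r\times\mathrm{id}_X)(\mathrm{id}_X\times r)$. Writing $r(a,b)=(\sigma_a(b),\tau_b(a))$, $r$ is left non-degenerate if $\sigma_a\in\mathrm{Sym}_X$ (the set of bijections of $X$) for every $a\in X$. A left shelf is a non-empty set $X$ with a binary operation $\triangleright$ such that $a\triangleright(b\triangleright c)=(a\triangleright b)\triangleright(a\triangleright c)$ for all $a,b,c\in X$. Put $L_a(b)=a\triangleright b$. $\mathrm{Aut}(X,\triangleright)$ denotes the set of bijections $g:X\to X$ with $g(a\triangleright b)=g(a)\triangleright g(b)$ for all $a,b$. A twist of a left shelf $(X,\triangleright)$ is a map $\varphi:X\to\mathrm{Aut}(X,\triangleright)$, $a\mapsto\varphi_a$, such that for all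 $a,b\in X$, $\varphi_a\varphi_b=\varphi_{\varphi_a(b)}\,\varphi_{\varphi^{-1}_{\varphi_a(b)}L_{\varphi_a(b)}(a)}$ (composition of maps). *)

theory Defs
  imports Main
begin

text \<open>The underlying set \<open>X\<close> is the type \<open>'a\<close>. HOL types are inhabited, which matches the
  requirement that a left shelf is non-empty. Triples are encoded as \<open>'a \<times> ('a \<times> 'a)\<close>.\<close>

definition r12 :: "('a \<times> 'a \<Rightarrow> 'a \<times> 'a) \<Rightarrow> 'a \<times> 'a \<times> 'a \<Rightarrow> 'a \<times> 'a \<times> 'a" where
  "r12 r = (\<lambda>(a, b, c). (fst (r (a, b)), snd (r (a, b)), c))"

definition r23 :: "('a \<times> 'a \<Rightarrow> 'a \<times> 'a) \<Rightarrow> 'a \<times> 'a \<times> 'a \<Rightarrow> 'a \<times> 'a \<times> 'a" where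
  "r23 r = (\<lambda>(a, b, c). (a, r (b, c)))"

definition solution :: "('a \<times> 'a \<Rightarrow> 'a \<times> 'a) \<Rightarrow> bool" where
  "solution r \<longleftrightarrow> r12 r \<circ> r23 r \<circ> r12 r = r23 r \<circ> r12 r \<circ> r23 r"

definition left_nondegenerate :: "('a \<times> 'a \<Rightarrow> 'a \<times> 'a) \<Rightarrow> bool" where
  "left_nondegenerate r \<longleftrightarrow> (\<forall>a. bij (\<lambda>b. fst (r (a, b))))"

definition left_shelf :: "('a \<Rightarrow> 'a \<Rightarrow> 'a) \<Rightarrow> bool" where
  "left_shelf L \<longleftrightarrow> (\<forall>a b c. L a (L b c) = L (L a b) (L a c))"

definition shelf_Aut :: "('a \<Rightarrow> 'a \<Rightarrow> 'a) \<Rightarrow> ('a \<Rightarrow> 'a) set" where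
  "shelf_Aut L = {g. bij g \<and> (\<forall>a b. g (L a b) = L (g a) (g b))}"

definition twist :: "('a \<Rightarrow> 'a \<Rightarrow> 'a) \<Rightarrow> ('a \<Rightarrow> 'a \<Rightarrow> 'a) \<Rightarrow> bool" where
  "twist L \<phi> \<longleftrightarrow> (\<forall>a. \<phi> a \<in> shelf_Aut L) \<and>
     (\<forall>a b. \<phi> a \<circ> \<phi> b = \<phi> (\<phi> a b) \<circ> \<phi> (inv (\<phi> (\<phi> a b)) (L (\<phi> a b) a)))"

definition r_twist :: "('a \<Rightarrow> 'a \<Rightarrow> 'a) \<Rightarrow> ('a \<Rightarrow> 'a \<Rightarrow> 'a) \<Rightarrow> 'a \<times> 'a \<Rightarrow> 'a \<times> 'a" where
  "r_twist L \<phi> = (\<lambda>(a, b). (\<phi> a b, inv (\<phi> (\<phi> a b)) (L (\<phi> a b) a)))"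

end

theory Submission
  imports Defs
begin

text \<open>
  Write a map as \<open>r (a, b) = (\<phi>\<^sub>a b, t a b)\<close> with every \<open>\<phi>\<^sub>a\<close> bijective, and
  link \<open>t\<close> to an operation \<open>L\<close> by the inverse-free relation
  \<open>\<phi> (\<phi> a b) (t a b) = L (\<phi> a b) a\<close>. Since the \<open>\<phi>\<^sub>a\<close> are bijective, this determines
  \<open>t\<close> from \<open>L\<close> and \<open>L\<close> from \<open>t\<close>. Comparing the three coordinates of the braid identity gives:

    \<^item> the first coordinate says \<open>\<phi> a \<circ> \<phi> b = \<phi> (\<phi> a b) \<circ> \<phi> (t a b)\<close>, which is literally the
      composition law of a twist;
    \<^item> given the first, the second says that every \<open>\<phi>\<^sub>a\<close> is a homomorphism for \<open>L\<close>
      (\<open>second_coordinate_iff\<close>);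
    \<^item> given the first two, the third says that \<open>L\<close> is left self-distributive
      (\<open>third_coordinate_iff\<close>).

  In the last two cases a suitable injective map built from the \<open>\<phi>\<close>'s is applied to both sides,
  and this makes \<open>t\<close> disappear. Hence for an arbitrary binary operation \<open>L\<close>,
  \<open>r_twist L \<phi>\<close> is a solution exactly when \<open>L\<close> is a left shelf and \<open>\<phi>\<close> is a twist of it. The
  first claim of the theorem is immediate. So is the second, because a left non-degenerate map is
  \<open>r_twist L \<phi>\<close> for some operation \<open>L\<close>, and being a solution then forces the shelf law.
\<close>

lemma solution_iff_coordinates:
  "solution (\<lambda>(a, b). (s a b, t a b)) \<longleftrightarrow>
     (\<forall>a b c. s a (s b c) = s (s a b) (s (t a b) c)) \<and>
     (\<forall>a b c. t (s a b) (s (t a b) c) = s (t a (s b c)) (t b c)) \<and>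
     (\<forall>a b c. t (t a b) c = t (t a (s b c)) (t b c))"
  unfolding solution_def r12_def r23_def by (auto simp: fun_eq_iff)

text \<open>
  Put \<open>d = \<phi> b c\<close>. Both sides of the second coordinate become free of \<open>t\<close> under the injective map
  \<open>\<phi> (\<phi> a d)\<close>: the left one becomes \<open>L (\<phi> a d) (\<phi> a b)\<close> and the right one \<open>\<phi> a (L d b)\<close>.
\<close>

lemma second_coordinate_iff:
  assumes inj: "\<And>a. inj (\<phi> a)"
    and t: "\<And>a b. \<phi> (\<phi> a b) (t a b) = L (\<phi> a b) a"
    and comp: "\<And>a b c. \<phi> a (\<phi> b c) = \<phi> (\<phi> a b) (\<phi> (t a b) c)"
  shows "t (\<phi> a b) (\<phi> (t a b) c) = \<phi> (t a (\<phi> b c)) (t b c) \<longleftrightarrow>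
         \<phi> a (L (\<phi> b c) b) = L (\<phi> a (\<phi> b c)) (\<phi> a b)"
proof -
  let ?w = "\<phi> a (\<phi> b c)"
  have "\<phi> ?w (t (\<phi> a b) (\<phi> (t a b) c)) = L ?w (\<phi> a b)"
    using t[of "\<phi> a b" "\<phi> (t a b) c"] by (simp add: comp[symmetric])
  moreover have "\<phi> ?w (\<phi> (t a (\<phi> b c)) (t b c)) = \<phi> a (L (\<phi> b c) b)"
    using comp[of a "\<phi> b c" "t b c"] by (simp add: t)
  ultimately show ?thesis
    by (metis inj injD)
qed

text \<open>
  The common injective map is now \<open>\<phi> x \<circ> \<phi> e\<close> with \<open>x = \<phi> a b\<close> and \<open>e = \<phi> (t a b) c\<close>. The
  composition law also writes it as \<open>\<phi> w \<circ> \<phi> g\<close>, where \<open>w = \<phi> x e\<close> and \<open>g = t x e\<close>; the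
  second coordinate rewrites \<open>g\<close> as \<open>\<phi> u f\<close>, where \<open>t u f\<close> is the right-hand side, so that
  \<open>\<phi> g\<close> turns \<open>t u f\<close> into \<open>L g u\<close>. The homomorphism property then moves \<open>\<phi> x\<close> and \<open>\<phi> w\<close> inside \<open>L\<close>.
\<close>

lemma third_coordinate_iff:
  assumes inj: "\<And>a. inj (\<phi> a)"
    and t: "\<And>a b. \<phi> (\<phi> a b) (t a b) = L (\<phi> a b) a"
    and comp: "\<And>a b c. \<phi> a (\<phi> b c) = \<phi> (\<phi> a b) (\<phi> (t a b) c)"
    and second: "\<And>a b c. t (\<phi> a b) (\<phi> (t a b) c) = \<phi> (t a (\<phi> b c)) (t b c)"
    and hom: "\<And>a x y. \<phi> a (L x y) = L (\<phi> a x) (\<phi> a y)"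
  shows "t (t a b) c = t (t a (\<phi> b c)) (t b c) \<longleftrightarrow>
         L (\<phi> a (\<phi> b c)) (L (\<phi> a b) a) =
         L (L (\<phi> a (\<phi> b c)) (\<phi> a b)) (L (\<phi> a (\<phi> b c)) a)"
proof -
  define x d y where "x = \<phi> a b" and "d = \<phi> b c" and "y = t a b"
  define e w u f where "e = \<phi> y c" and "w = \<phi> a d" and "u = t a d" and "f = t b c"
  have w: "\<phi> x e = w"
    using comp[of a b c] by (simp add: x_def e_def y_def w_def d_def)
  have g: "t x e = \<phi> u f"
    using second[of a b c] by (simp add: x_def e_def y_def u_def d_def f_def)
  have y: "\<phi> x y = L x a" and u: "\<phi> w u = L w a"
    using t by (simp_all add: x_def y_def w_def u_def)
  have left: "\<phi> x (\<phi> e (t y c)) = L w (L x a)"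
    using t[of y c] by (simp add: e_def[symmetric] hom w y)
  have "\<phi> x (\<phi> e (t u f)) = \<phi> w (\<phi> (t x e) (t u f))"
    using comp[of x e "t u f"] by (simp add: w)
  also have "\<dots> = \<phi> w (L (t x e) u)"
    using t[of u f] by (simp add: g)
  also have "\<dots> = L (L w x) (L w a)"
    using t[of x e] by (simp add: hom w u)
  finally have right: "\<phi> x (\<phi> e (t u f)) = L (L w x) (L w a)" .
  have "t y c = t u f \<longleftrightarrow> L w (L x a) = L (L w x) (L w a)"
    unfolding left[symmetric] right[symmetric] by (metis inj injD)
  then show ?thesis
    by (simp add: x_def d_def y_def w_def u_def f_def)
qed

text \<open>
  The identities of the two preceding lemmas only involve values of the \<open>\<phi>\<^sub>a\<close>. By surjectivity
  these values range over all of the type, so the identities become the homomorphism law and the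
  shelf law.
\<close>

lemma solution_r_twist_iff:
  assumes bij: "\<And>a. bij (\<phi> a)"
  shows "solution (r_twist L \<phi>) \<longleftrightarrow> left_shelf L \<and> twist L \<phi>"
proof -
  define t where "t a b = inv (\<phi> (\<phi> a b)) (L (\<phi> a b) a)" for a b
  have inj: "inj (\<phi> a)" and surj: "surj (\<phi> a)" for a
    using bij by (simp_all add: bij_is_inj bij_is_surj)
  have t: "\<phi> (\<phi> a b) (t a b) = L (\<phi> a b) a" for a b
    by (simp add: t_def surj_f_inv_f surj)
  let ?first = "\<forall>a b c. \<phi> a (\<phi> b c) = \<phi> (\<phi> a b) (\<phi> (t a b) c)"
  let ?second = "\<forall>a b c. t (\<phi> a b) (\<phi> (t a b) c) = \<phi> (t a (\<phi> b c)) (t b c)"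
  let ?third = "\<forall>a b c. t (t a b) c = t (t a (\<phi> b c)) (t b c)"
  let ?hom = "\<forall>a x y. \<phi> a (L x y) = L (\<phi> a x) (\<phi> a y)"
  have "r_twist L \<phi> = (\<lambda>(a, b). (\<phi> a b, t a b))"
    by (simp add: r_twist_def t_def)
  then have sol: "solution (r_twist L \<phi>) \<longleftrightarrow> ?first \<and> ?second \<and> ?third"
    by (simp add: solution_iff_coordinates)
  have tw: "twist L \<phi> \<longleftrightarrow> ?first \<and> ?hom"
    by (auto simp: twist_def shelf_Aut_def bij fun_eq_iff t_def)
  have second: "?second \<longleftrightarrow> ?hom" if comp: ?first
  proof -
    have "?second \<longleftrightarrow> (\<forall>a b c. \<phi> a (L (\<phi> b c) b) = L (\<phi> a (\<phi> b c)) (\<phi> a b))"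
      by (simp only: second_coordinate_iff[of \<phi> t L, OF inj t comp[rule_format]])
    also have "\<dots> \<longleftrightarrow> ?hom"
    proof (intro iffI allI)
      fix a x y
      assume *: "\<forall>a b c. \<phi> a (L (\<phi> b c) b) = L (\<phi> a (\<phi> b c)) (\<phi> a b)"
      obtain c where "x = \<phi> y c"
        using surjD[OF surj] by blast
      with * show "\<phi> a (L x y) = L (\<phi> a x) (\<phi> a y)"
        by simp
    qed simp
    finally show ?thesis .
  qed
  have third: "?third \<longleftrightarrow> left_shelf L" if comp: ?first and sec: ?second and hom: ?hom
  proof -
    have "?third \<longleftrightarrow> (\<forall>a b c. L (\<phi> a (\<phi> b c)) (L (\<phi> a b) a) =
         L (L (\<phi> a (\<phi> b c)) (\<phi> a b)) (L (\<phi> a (\<phi> b c)) a))"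
      by (simp only: third_coordinate_iff[of \<phi> t L, OF inj t comp[rule_format]
            sec[rule_format] hom[rule_format]])
    also have "\<dots> \<longleftrightarrow> left_shelf L"
      unfolding left_shelf_def
    proof (intro iffI allI)
      fix w x a
      assume *: "\<forall>a b c. L (\<phi> a (\<phi> b c)) (L (\<phi> a b) a) =
         L (L (\<phi> a (\<phi> b c)) (\<phi> a b)) (L (\<phi> a (\<phi> b c)) a)"
      obtain b where b: "x = \<phi> a b"
        using surjD[OF surj] by blast
      obtain d where d: "w = \<phi> a d"
        using surjD[OF surj] by blast
      obtain c where "d = \<phi> b c"
        using surjD[OF surj] by blast
      with b d * show "L w (L x a) = L (L w x) (L w a)"
        by simp
    qed simp
    finally show ?thesis .
  qed
  show ?thesis
    using sol tw second third by blast
qed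

text \<open>
  The relation \<open>\<phi> (\<phi> a b) (t a b) = L (\<phi> a b) a\<close>, read as a definition of \<open>L c a\<close> at
  \<open>c = \<phi> a b\<close>, makes sense because \<open>b\<close> is recovered from \<open>a\<close> and \<open>c\<close> by inverting \<open>\<phi> a\<close>.
\<close>

lemma left_nondegenerate_is_r_twist:
  assumes "left_nondegenerate r"
  obtains L \<phi> where "\<And>a. bij (\<phi> a)" and "r = r_twist L \<phi>"
proof -
  define \<phi> where "\<phi> a b = fst (r (a, b))" for a b
  define L where "L c a = \<phi> c (snd (r (a, inv (\<phi> a) c)))" for c a
  have bij: "bij (\<phi> a)" for a
    using assms by (simp add: left_nondegenerate_def \<phi>_def[abs_def])
  have "inv (\<phi> (\<phi> a b)) (L (\<phi> a b) a) = snd (r (a, b))" for a b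
    by (simp add: L_def inv_f_f bij_is_inj bij)
  then have "r = r_twist L \<phi>"
    by (auto simp: r_twist_def fun_eq_iff \<phi>_def prod_eq_iff)
  with bij show thesis by (rule that)
qed

theorem theorem2p15:
  shows "(\<forall>(L :: 'a \<Rightarrow> 'a \<Rightarrow> 'a) \<phi>. left_shelf L \<and> (\<forall>a. bij (\<phi> a)) \<longrightarrow>
            (solution (r_twist L \<phi>) \<longleftrightarrow> twist L \<phi>)) \<and>
         (\<forall>r :: 'a \<times> 'a \<Rightarrow> 'a \<times> 'a. solution r \<and> left_nondegenerate r \<longrightarrow>
            (\<exists>L \<phi>. left_shelf L \<and> twist L \<phi> \<and> r = r_twist L \<phi>))"
proof (intro conjI allI impI)
  fix L \<phi> :: "'a \<Rightarrow> 'a \<Rightarrow> 'a"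
  assume "left_shelf L \<and> (\<forall>a. bij (\<phi> a))"
  then show "solution (r_twist L \<phi>) \<longleftrightarrow> twist L \<phi>"
    by (simp add: solution_r_twist_iff)
next
  fix r :: "'a \<times> 'a \<Rightarrow> 'a \<times> 'a"
  assume r: "solution r \<and> left_nondegenerate r"
  then obtain L \<phi> where "\<And>a. bij (\<phi> a)" and "r = r_twist L \<phi>"
    by (blast elim: left_nondegenerate_is_r_twist)
  with r show "\<exists>L \<phi>. left_shelf L \<and> twist L \<phi> \<and> r = r_twist L \<phi>"
    using solution_r_twist_iff[of \<phi> L] by auto
qed

end
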